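(* Let $p,q\ge 1$ be integers and let $T$ be a semi-infinite stochastic banded matrix ($p$ subdiagonals, $q$ superdiagonals) that admits a positive bidiagonal factorization $T=\mathscr L_1\cdots\mathscr L_p\,\mathscr U_q\cdots\mathscr U_1$. Let $e=(1,1,\dots)^\top$, $\delta_0=I$, and define recursively the positive diagonal matrices $$\delta_j:=\delta(\mathscr U_j\delta_{j-1}e),\quad j\in\{1,\dots,q\},\qquad \delta_{q+i}:=\delta(\mathscr L_{p+1-i}\,\delta_{q+i-1}e),\quad i\in\{1,\dots,p\}.$$ Then the matrices $$\hat{\mathscr U}_j=\delta_j^{-1}\mathscr U_j\delta_{j-1},\quad j\in\{1,\dots,q\},\qquad \hat{\mathscr L}_i=\delta_{q+p-i+1}^{-1}\mathscr L_i\,\delta_{q+p-i},\quad i\in\{1,\dots,p\},$$ are positive bidiagonal stochastic matrices (lower bidiagonal for $\hat{\mathscr L}_i$, upper bidiagonal for $\hat{\mathscr U}_j$), and $$T=\hat{\mathscr L}_1\cdots\hat{\mathscr L}_p\,\hat{\mathscr U}_q\cdots\hat{\mathscr U}_1 .$$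
   Context: All matrices are real semi-infinite, with rows and columns indexed by $\mathbb N_0=\{0,1,2,\dots\}$. A matrix is stochastic if all its entries are nonnegative and each row sums to $1$ (i.e. it maps $e$ to $e$). Banded means $T_{n,m}=0$ unless $n-p\le m\le n+q$; the entries inside the band are positive. For a semi-infinite vector $v=(v_0,v_1,\dots)^\top$, $\delta(v)=\operatorname{diag}(v_0,v_1,\dots)$. A positive lower bidiagonal matrix $\mathscr L$ has $\mathscr L_{i,i}>0$ and $\mathscr L_{i+1,i}>0$ for all $i\in\mathbb N_0$ and all other entries $0$; a positive upper bidiagonal matrix $\mathscr U$ has $\mathscr U_{i,i}>0$ and $\mathscr U_{i,i+1}>0$ for all $i\in\mathbb N_0$ and all other entries $0$. A positive bidiagonal factorization of $T$ is a factorization $T=\mathscr L_1\cdots\mathscr L_p\mathscr U_q\cdots\mathscr U_1$ with all $\mathscr L_i$ positive lower bidiagonal and all $\mathscr U_j$ positive upper bidiagonal. *)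

theory Defs
  imports Complex_Main
begin

type_synonym smat = "nat \<Rightarrow> nat \<Rightarrow> real"
type_synonym svec = "nat \<Rightarrow> real"

text \<open>Matrix products are defined by entrywise series. In products of banded matrices each
  series has only finitely many nonzero terms; for such row-finite matrices the product is
  associative, which fails for arbitrary semi-infinite matrices.\<close>

definition smat_mult :: "smat \<Rightarrow> smat \<Rightarrow> smat" (infixl "\<odot>" 70) where
  "A \<odot> B = (\<lambda>n m. \<Sum>k. A n k * B k m)"

definition smat_vec :: "smat \<Rightarrow> svec \<Rightarrow> svec" (infixr "\<odot>\<^sub>v" 70) where
  "A \<odot>\<^sub>v v = (\<lambda>n. \<Sum>k. A n k * v k)"

definition sdiag :: "svec \<Rightarrow> smat" where
  "sdiag v = (\<lambda>n m. if n = m then v n else 0)"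

definition ones :: svec where
  "ones = (\<lambda>_. 1)"

definition smat_one :: smat where
  "smat_one = (\<lambda>n m. if n = m then 1 else 0)"

definition smat_prod :: "smat list \<Rightarrow> smat" where
  "smat_prod As = foldr (\<odot>) As smat_one"

text \<open>A semi-infinite matrix may fail to have a unique two-sided inverse, in which case the value
  below is meaningless; for diagonal matrices with nonzero diagonal it is unique, see
  \<open>smat_inv_sdiag\<close>.\<close>

definition smat_inv :: "smat \<Rightarrow> smat" where
  "smat_inv A = (THE B. A \<odot> B = smat_one \<and> B \<odot> A = smat_one)"

definition stochastic :: "smat \<Rightarrow> bool" where
  "stochastic A \<longleftrightarrow> (\<forall>n m. 0 \<le> A n m) \<and> (\<forall>n. (\<lambda>m. A n m) sums 1)"

text \<open>The band condition \<open>n - p \<le> m\<close> is written as \<open>n \<le> m + p\<close> because subtraction on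
  \<open>nat\<close> truncates.\<close>

definition banded :: "nat \<Rightarrow> nat \<Rightarrow> smat \<Rightarrow> bool" where
  "banded p q A \<longleftrightarrow>
     (\<forall>n m. if n \<le> m + p \<and> m \<le> n + q then 0 < A n m else A n m = 0)"

definition positive_diagonal :: "smat \<Rightarrow> bool" where
  "positive_diagonal D \<longleftrightarrow> (\<forall>n m. if n = m then 0 < D n m else D n m = 0)"

definition positive_lower_bidiagonal :: "smat \<Rightarrow> bool" where
  "positive_lower_bidiagonal A \<longleftrightarrow>
     (\<forall>n m. if n = m \<or> n = Suc m then 0 < A n m else A n m = 0)"

definition positive_upper_bidiagonal :: "smat \<Rightarrow> bool" where
  "positive_upper_bidiagonal A \<longleftrightarrow>
     (\<forall>n m. if m = n \<or> m = Suc n then 0 < A n m else A n m = 0)"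

text \<open>The product \<open>L 1 \<cdots> L p U q \<cdots> U 1\<close>; only the values \<open>L i\<close> for \<open>i \<in> {1..p}\<close> and \<open>U j\<close>
  for \<open>j \<in> {1..q}\<close> matter.\<close>

definition LU_product :: "nat \<Rightarrow> nat \<Rightarrow> (nat \<Rightarrow> smat) \<Rightarrow> (nat \<Rightarrow> smat) \<Rightarrow> smat" where
  "LU_product p q L U = smat_prod (map L [1..<Suc p] @ map U (rev [1..<Suc q]))"

definition positive_bidiagonal_factorization ::
    "nat \<Rightarrow> nat \<Rightarrow> (nat \<Rightarrow> smat) \<Rightarrow> (nat \<Rightarrow> smat) \<Rightarrow> smat \<Rightarrow> bool" where
  "positive_bidiagonal_factorization p q L U T \<longleftrightarrow>
     (\<forall>i\<in>{1..p}. positive_lower_bidiagonal (L i)) \<and>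
     (\<forall>j\<in>{1..q}. positive_upper_bidiagonal (U j)) \<and>
     T = LU_product p q L U"

lemma sdiag_mult: "sdiag d \<odot> B = (\<lambda>n m. d n * B n m)"
proof (intro ext)
  fix n m
  have "(\<Sum>k. sdiag d n k * B k m) = (\<Sum>k\<in>{n}. sdiag d n k * B k m)"
    by (rule suminf_finite) (auto simp: sdiag_def)
  then show "(sdiag d \<odot> B) n m = d n * B n m"
    by (simp add: smat_mult_def sdiag_def)
qed

lemma mult_sdiag: "B \<odot> sdiag d = (\<lambda>n m. B n m * d m)"
proof (intro ext)
  fix n m
  have "(\<Sum>k. B n k * sdiag d k m) = (\<Sum>k\<in>{m}. B n k * sdiag d k m)"
    by (rule suminf_finite) (auto simp: sdiag_def)
  then show "(B \<odot> sdiag d) n m = B n m * d m"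
    by (simp add: smat_mult_def sdiag_def)
qed

lemma smat_inv_sdiag:
  assumes "\<And>n. d n \<noteq> 0"
  shows "smat_inv (sdiag d) = sdiag (\<lambda>n. inverse (d n))"
  unfolding smat_inv_def
proof (rule the_equality)
  show "sdiag d \<odot> sdiag (\<lambda>n. inverse (d n)) = smat_one \<and>
        sdiag (\<lambda>n. inverse (d n)) \<odot> sdiag d = smat_one"
    unfolding sdiag_mult using assms by (auto simp: sdiag_def smat_one_def fun_eq_iff)
next
  fix B assume "sdiag d \<odot> B = smat_one \<and> B \<odot> sdiag d = smat_one"
  then have *: "d n * B n m = (if n = m then 1 else 0)" for n m
    by (auto simp: sdiag_mult smat_one_def fun_eq_iff)
  show "B = sdiag (\<lambda>n. inverse (d n))"
  proof (intro ext)
    fix n m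
    show "B n m = sdiag (\<lambda>n. inverse (d n)) n m"
      using *[of n m] assms[of n] by (auto simp: sdiag_def field_simps split: if_splits)
  qed
qed

end

theory Submission
  imports Defs
begin

text \<open>Multiply all the factors in order, starting from \<open>U 1\<close>. Rescaling makes the diagonal matrices
  telescope, so the rescaled partial products are the original ones with row \<open>n\<close> divided by the
  \<open>n\<close>th entry of the current scaling vector. That entry is also the row sum of the original
  partial product. For the full product \<open>T\<close> the row sums are \<open>1\<close>, so the last scaling is trivial.
  Row-finiteness of the factors justifies all manipulations of the series.\<close>

definition row_finite :: "smat \<Rightarrow> bool" where
  "row_finite A \<longleftrightarrow> (\<forall>n. finite {k. A n k \<noteq> 0})"

lemma row_finiteI:
  assumes "\<And>n k. A n k \<noteq> 0 \<Longrightarrow> k \<le> Suc n"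
  shows "row_finite A"
  unfolding row_finite_def
proof
  fix n
  show "finite {k. A n k \<noteq> 0}"
    by (rule finite_subset[of _ "{..Suc n}"]) (use assms in auto)
qed

lemma row_finite_lower: "positive_lower_bidiagonal A \<Longrightarrow> row_finite A"
  by (rule row_finiteI) (metis Suc_n_not_le_n le_cases le_SucI positive_lower_bidiagonal_def)

lemma row_finite_upper: "positive_upper_bidiagonal A \<Longrightarrow> row_finite A"
  by (rule row_finiteI) (metis le_refl le_SucI positive_upper_bidiagonal_def)

text \<open>Row \<open>n\<close> has finite support, so the series is a finite sum for every
  \<open>f\<close>. In a product, row-finiteness is therefore asked of the left factor
  alone.\<close>

lemma row_finite_sums:
  assumes "row_finite A"
  shows "(\<lambda>k. A n k * f k) sums (\<Sum>k | A n k \<noteq> 0. A n k * f k)"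
  by (rule sums_finite) (use assms in \<open>auto simp: row_finite_def\<close>)

lemma smat_vec_row_finite:
  "row_finite A \<Longrightarrow> (A \<odot>\<^sub>v v) n = (\<Sum>k | A n k \<noteq> 0. A n k * v k)"
  unfolding smat_vec_def by (rule sums_unique[symmetric]) (rule row_finite_sums)

lemma smat_mult_row_finite:
  "row_finite A \<Longrightarrow> (A \<odot> B) n m = (\<Sum>k | A n k \<noteq> 0. A n k * B k m)"
  unfolding smat_mult_def by (rule sums_unique[symmetric]) (rule row_finite_sums)

lemma sdiag_vec: "sdiag d \<odot>\<^sub>v v = (\<lambda>n. d n * v n)"
proof
  fix n
  have "(\<Sum>k. sdiag d n k * v k) = (\<Sum>k\<in>{n}. sdiag d n k * v k)"
    by (rule suminf_finite) (auto simp: sdiag_def)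
  then show "(sdiag d \<odot>\<^sub>v v) n = d n * v n"
    by (simp add: smat_vec_def sdiag_def)
qed

lemma smat_one_eq_sdiag: "smat_one = sdiag (\<lambda>_. 1)"
  by (simp add: smat_one_def sdiag_def)

text \<open>The diagonal term is positive and all other terms are nonnegative. This keeps the
  scaling vectors positive, hence invertible as diagonals.\<close>

lemma smat_vec_pos:
  assumes "row_finite A" "\<And>n m. 0 \<le> A n m" "0 < A n n" "\<And>m. 0 < v m"
  shows "0 < (A \<odot>\<^sub>v v) n"
  unfolding smat_vec_row_finite[OF assms(1)]
  by (rule sum_pos2[of _ n])
    (use assms in \<open>auto simp: row_finite_def less_imp_le\<close>)

text \<open>Scaling the columns by \<open>v\<close> turns the sum of row \<open>n\<close> into the
  \<open>n\<close>th entry of \<open>A\<close> applied to \<open>v\<close>, and the left factor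
  divides by exactly that entry.\<close>

lemma stochastic_rescaled:
  assumes "row_finite A" "\<And>n m. 0 \<le> A n m" "\<And>m. 0 < v m" "\<And>n. 0 < (A \<odot>\<^sub>v v) n"
  shows "stochastic (\<lambda>n m. inverse ((A \<odot>\<^sub>v v) n) * A n m * v m)"
  unfolding stochastic_def
proof (intro conjI allI)
  fix n m
  show "0 \<le> inverse ((A \<odot>\<^sub>v v) n) * A n m * v m"
    using assms by (simp add: less_imp_le)
  have "(\<lambda>k. A n k * v k) sums (A \<odot>\<^sub>v v) n"
    using row_finite_sums[OF assms(1)] by (simp add: smat_vec_row_finite[OF assms(1)])
  from sums_mult[OF this, of "inverse ((A \<odot>\<^sub>v v) n)"]
  show "(\<lambda>m. inverse ((A \<odot>\<^sub>v v) n) * A n m * v m) sums 1"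
    using assms(4)[of n] by (simp add: mult.assoc)
qed

text \<open>The sum over \<open>k\<close> is finite, so it may be interchanged with the series over
  \<open>m\<close>.\<close>

lemma smat_mult_sums:
  assumes "row_finite A" "\<And>k. (\<lambda>m. B k m) sums s k"
  shows "(\<lambda>m. (A \<odot> B) n m) sums (A \<odot>\<^sub>v s) n"
  unfolding smat_mult_row_finite[OF assms(1)] smat_vec_row_finite[OF assms(1)]
  by (intro sums_sum sums_mult assms)

text \<open>Indices decrease from left to right. With the right bracketing of \<open>foldr\<close>,
  an induction step adds one factor on the left, the side where row-finiteness matters.\<close>

definition descending_prod :: "(nat \<Rightarrow> smat) \<Rightarrow> nat \<Rightarrow> smat" where
  "descending_prod M k = smat_prod (map M (rev [1..<Suc k]))"

lemma descending_prod_0: "descending_prod M 0 = smat_one"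
  by (simp add: descending_prod_def smat_prod_def)

lemma descending_prod_Suc: "descending_prod M (Suc k) = M (Suc k) \<odot> descending_prod M k"
  by (simp add: descending_prod_def smat_prod_def)

text \<open>Both sides obey the same recursion: a new left factor acts on the vector of row sums,
  starting from the row sums of the identity.\<close>

lemma descending_prod_row_sums:
  assumes "\<And>j. j < k \<Longrightarrow> row_finite (M (Suc j))"
    and "\<And>j. j < k \<Longrightarrow> d (Suc j) = M (Suc j) \<odot>\<^sub>v d j"
    and "d 0 = (\<lambda>_. 1)"
  shows "(\<lambda>m. descending_prod M k n m) sums d k n"
  using assms
proof (induction k arbitrary: n)
  case 0
  show ?case
    using sums_single[of n "\<lambda>_. 1::real"]
    by (simp add: descending_prod_0 smat_one_def 0(3) eq_commute[of n])
next
  case (Suc k)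
  then show ?case
    by (simp add: descending_prod_Suc smat_mult_sums)
qed

text \<open>The column scaling of each factor cancels the row scaling of the partial product to its
  right. No column scaling survives at the right end because \<open>d 0\<close> is constantly
  1.\<close>

lemma descending_prod_rescaled:
  assumes "\<And>j. j < k \<Longrightarrow> row_finite (M (Suc j))"
    and "\<And>j n. j \<le> k \<Longrightarrow> 0 < d j n"
    and "\<And>j. j < k \<Longrightarrow> N (Suc j) = (\<lambda>n m. inverse (d (Suc j) n) * M (Suc j) n m * d j m)"
    and "d 0 = (\<lambda>_. 1)"
  shows "descending_prod N k n m = inverse (d k n) * descending_prod M k n m"
  using assms
proof (induction k arbitrary: n)
  case 0
  then show ?case
    by (simp add: descending_prod_0)
next
  case (Suc k)
  have IH: "descending_prod N k l m = inverse (d k l) * descending_prod M k l m" for l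
    using Suc.prems by (intro Suc.IH) auto
  have "N (Suc k) n l * descending_prod N k l m
      = inverse (d (Suc k) n) * (M (Suc k) n l * descending_prod M k l m)" for l
    using Suc.prems(2)[of k l] Suc.prems(3)[of k] by (simp add: IH)
  \<comment> \<open>Summability allows the constant \<open>inverse (d (Suc k) n)\<close> to be
    pulled out of the series.\<close>
  moreover have "summable (\<lambda>l. M (Suc k) n l * descending_prod M k l m)"
    by (rule sums_summable[OF row_finite_sums]) (simp add: Suc.prems(1))
  ultimately show ?case
    by (simp add: descending_prod_Suc smat_mult_def suminf_mult)
qed

text \<open>The single sequence of factors that merges \<open>U 1, \<dots>, U q, L p, \<dots>, L 1\<close>.\<close>

definition merged_factors :: "nat \<Rightarrow> nat \<Rightarrow> (nat \<Rightarrow> smat) \<Rightarrow> (nat \<Rightarrow> smat) \<Rightarrow> nat \<Rightarrow> smat" where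
  "merged_factors p q L U k = (if k \<le> q then U k else L (q + p + 1 - k))"

lemma LU_product_eq_descending_prod:
  "LU_product p q L U = descending_prod (merged_factors p q L U) (q + p)"
proof -
  let ?M = "merged_factors p q L U"
  have split: "[1..<Suc (q + p)] = [1..<Suc q] @ [Suc q..<Suc (q + p)]"
    using upt_add_eq_append[of 1 "Suc q" p] by simp
  \<comment> \<open>Position \<open>i\<close> (from 0) of the reversed list holds
    \<open>q + p - i\<close>, which \<open>?M\<close> sends to \<open>L (i + 1)\<close>.\<close>
  have "map L [1..<Suc p] = map ?M (rev [Suc q..<Suc (q + p)])"
    by (rule nth_equalityI) (auto simp: rev_nth nth_append merged_factors_def simp del: upt_Suc)
  moreover have "map U (rev [1..<Suc q]) = map ?M (rev [1..<Suc q])"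
    by (simp add: merged_factors_def del: upt_Suc)
  ultimately show ?thesis
    by (simp only: LU_product_def descending_prod_def split rev_append map_append)
qed

lemma positive_upper_bidiagonal_rescaled:
  "positive_upper_bidiagonal A \<Longrightarrow> (\<And>n. 0 < v n) \<Longrightarrow> (\<And>n. 0 < w n) \<Longrightarrow>
    positive_upper_bidiagonal (\<lambda>n m. v n * A n m * w m)"
  by (simp add: positive_upper_bidiagonal_def)

lemma positive_lower_bidiagonal_rescaled:
  "positive_lower_bidiagonal A \<Longrightarrow> (\<And>n. 0 < v n) \<Longrightarrow> (\<And>n. 0 < w n) \<Longrightarrow>
    positive_lower_bidiagonal (\<lambda>n m. v n * A n m * w m)"
  by (simp add: positive_lower_bidiagonal_def)

theorem proposition2p3:
  fixes p q :: nat
    and T :: smat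
    and L U :: "nat \<Rightarrow> smat"
    and \<delta> :: "nat \<Rightarrow> smat"
    and Lhat Uhat :: "nat \<Rightarrow> smat"
  assumes "1 \<le> p" and "1 \<le> q"
    and "stochastic T"
    and "banded p q T"
    and "positive_bidiagonal_factorization p q L U T"
    and "\<delta> 0 = smat_one"
    and "\<forall>j\<in>{1..q}. \<delta> j = sdiag (U j \<odot>\<^sub>v \<delta> (j - 1) \<odot>\<^sub>v ones)"
    and "\<forall>i\<in>{1..p}. \<delta> (q + i) = sdiag (L (p + 1 - i) \<odot>\<^sub>v \<delta> (q + i - 1) \<odot>\<^sub>v ones)"
    and "\<forall>j\<in>{1..q}. Uhat j = smat_inv (\<delta> j) \<odot> U j \<odot> \<delta> (j - 1)"
    and "\<forall>i\<in>{1..p}. Lhat i = smat_inv (\<delta> (q + p - i + 1)) \<odot> L i \<odot> \<delta> (q + p - i)"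
  shows "(\<forall>k\<in>{0..q + p}. positive_diagonal (\<delta> k)) \<and>
         (\<forall>j\<in>{1..q}. positive_upper_bidiagonal (Uhat j) \<and> stochastic (Uhat j)) \<and>
         (\<forall>i\<in>{1..p}. positive_lower_bidiagonal (Lhat i) \<and> stochastic (Lhat i)) \<and>
         T = LU_product p q Lhat Uhat"
proof -
  define M where "M = merged_factors p q L U"
  define N where "N = merged_factors p q Lhat Uhat"
  define d where "d k = \<delta> k \<odot>\<^sub>v ones" for k
  have L: "\<And>i. i \<in> {1..p} \<Longrightarrow> positive_lower_bidiagonal (L i)"
    and U: "\<And>j. j \<in> {1..q} \<Longrightarrow> positive_upper_bidiagonal (U j)"
    and T: "T = descending_prod M (q + p)"
    using assms(5)
    by (auto simp: positive_bidiagonal_factorization_def M_def LU_product_eq_descending_prod)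

  \<comment> \<open>These properties are shared by both kinds of factors and suffice for positivity
    and row sums.\<close>
  have M_props: "row_finite (M (Suc k)) \<and> (\<forall>n m. 0 \<le> M (Suc k) n m) \<and> (\<forall>n. 0 < M (Suc k) n n)"
    if "k < q + p" for k
  proof (cases "Suc k \<le> q")
    case True
    then have "positive_upper_bidiagonal (M (Suc k))"
      using U by (simp add: M_def merged_factors_def)
    then show ?thesis
      by (metis row_finite_upper positive_upper_bidiagonal_def less_imp_le order_refl)
  next
    case False
    then have "positive_lower_bidiagonal (M (Suc k))"
      using that by (auto intro!: L simp: M_def merged_factors_def)
    then show ?thesis
      by (metis row_finite_lower positive_lower_bidiagonal_def less_imp_le order_refl)
  qed

  have d0: "d 0 = (\<lambda>_. 1)"
    by (simp add: d_def assms(6) smat_one_eq_sdiag sdiag_vec ones_def)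
  have \<delta>_Suc: "\<delta> (Suc k) = sdiag (M (Suc k) \<odot>\<^sub>v d k)" if "k < q + p" for k
  proof (cases "Suc k \<le> q")
    case True
    then show ?thesis
      using assms(7)[rule_format, of "Suc k"] by (simp add: M_def merged_factors_def d_def)
  next
    case False
    \<comment> \<open>This solves \<open>q + i = Suc k\<close>; the subtraction is exact because
      \<open>q < Suc k\<close>.\<close>
    define i where "i = Suc k - q"
    have "i \<in> {1..p}" "q + i = Suc k" "q + i - 1 = k" "p + 1 - i = q + p - k"
      using False that by (auto simp: i_def)
    then have "\<delta> (Suc k) = sdiag (L (q + p - k) \<odot>\<^sub>v \<delta> k \<odot>\<^sub>v ones)"
      using assms(8) by metis
    then show ?thesis
      using False by (simp add: M_def merged_factors_def d_def)
  qed
  have d_Suc: "d (Suc k) = M (Suc k) \<odot>\<^sub>v d k" if "k < q + p" for k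
    unfolding d_def[of "Suc k"] \<delta>_Suc[OF that] by (simp add: sdiag_vec ones_def)
  have \<delta>_eq: "\<delta> k = sdiag (d k)" if "k \<le> q + p" for k
  proof (cases k)
    case 0
    then show ?thesis
      by (simp add: d0 assms(6) smat_one_eq_sdiag)
  next
    case (Suc j)
    then show ?thesis
      using that \<delta>_Suc[of j] d_Suc[of j] by simp
  qed
  have d_pos: "0 < d k n" if "k \<le> q + p" for k n
    using that
  proof (induction k arbitrary: n)
    case 0
    show ?case
      by (simp add: d0)
  next
    case (Suc k)
    then show ?case
      using M_props[of k] by (simp add: d_Suc smat_vec_pos)
  qed

  have rescale: "smat_inv (\<delta> (Suc k)) \<odot> A \<odot> \<delta> k = (\<lambda>n m. inverse (d (Suc k) n) * A n m * d k m)"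
    if "k < q + p" for k A
  proof -
    \<comment> \<open>Nonzero diagonal entries make \<open>smat_inv\<close> a genuine inverse
      here.\<close>
    have "d (Suc k) n \<noteq> 0" for n
      using d_pos[of "Suc k" n] that by simp
    then show ?thesis
      using that by (simp add: \<delta>_eq smat_inv_sdiag sdiag_mult mult_sdiag)
  qed
  have N_Suc: "N (Suc k) = (\<lambda>n m. inverse (d (Suc k) n) * M (Suc k) n m * d k m)"
    if "k < q + p" for k
  proof (cases "Suc k \<le> q")
    case True
    then show ?thesis
      using assms(9)[rule_format, of "Suc k"] rescale[OF that]
      by (simp add: M_def N_def merged_factors_def)
  next
    case False
    \<comment> \<open>Here \<open>i\<close> is the index of the lower factor at position
      \<open>Suc k\<close>, unlike the offset past \<open>q\<close> used for \<delta>.\<close>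
    define i where "i = q + p - k"
    have "i \<in> {1..p}" "q + p - i + 1 = Suc k" "q + p - i = k"
      using False that by (auto simp: i_def)
    then have "Lhat i = smat_inv (\<delta> (Suc k)) \<odot> L i \<odot> \<delta> k"
      using assms(10) by metis
    then show ?thesis
      using False rescale[OF that] by (simp add: M_def N_def merged_factors_def i_def)
  qed
  have N_stochastic: "stochastic (N (Suc k))" if "k < q + p" for k
    unfolding N_Suc[OF that] d_Suc[OF that]
    by (rule stochastic_rescaled) (use that M_props[OF that] d_pos d_Suc[OF that, symmetric] in auto)

  \<comment> \<open>Stochasticity of \<open>T\<close> enters here: its row sums are computed in two
    ways.\<close>
  have "d (q + p) n = 1" for n
  proof -
    have "(\<lambda>m. T n m) sums d (q + p) n"
      unfolding T by (rule descending_prod_row_sums) (use M_props d_Suc d0 in auto)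
    moreover have "(\<lambda>m. T n m) sums 1"
      using assms(3) by (simp add: stochastic_def)
    ultimately show ?thesis
      by (rule sums_unique2)
  qed
  moreover have "descending_prod N (q + p) n m = inverse (d (q + p) n) * T n m" for n m
    unfolding T by (rule descending_prod_rescaled) (use M_props d_pos N_Suc d0 in auto)
  ultimately have "T = LU_product p q Lhat Uhat"
    by (simp add: LU_product_eq_descending_prod N_def fun_eq_iff)
  moreover have "positive_diagonal (\<delta> k)" if "k \<le> q + p" for k
    using that d_pos by (simp add: \<delta>_eq positive_diagonal_def sdiag_def)
  moreover have "positive_upper_bidiagonal (Uhat j) \<and> stochastic (Uhat j)" if "j \<in> {1..q}" for j
  proof -
    define k where "k = j - 1"
    have k: "k < q + p" and MN: "M (Suc k) = U j" "N (Suc k) = Uhat j"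
      using that by (auto simp: k_def M_def N_def merged_factors_def)
    have "positive_upper_bidiagonal (N (Suc k))"
      unfolding N_Suc[OF k] MN(1)
      by (intro positive_upper_bidiagonal_rescaled U that) (use k d_pos in auto)
    then show ?thesis
      using N_stochastic[OF k] MN by simp
  qed
  moreover have "positive_lower_bidiagonal (Lhat i) \<and> stochastic (Lhat i)" if "i \<in> {1..p}" for i
  proof -
    \<comment> \<open>\<open>L i\<close> sits at position \<open>q + p + 1 - i\<close>, which
      exceeds \<open>q\<close> since \<open>i\<close> is at most \<open>p\<close>.\<close>
    define k where "k = q + p - i"
    have k: "k < q + p" and MN: "M (Suc k) = L i" "N (Suc k) = Lhat i"
      using that by (auto simp: k_def M_def N_def merged_factors_def)
    have "positive_lower_bidiagonal (N (Suc k))"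
      unfolding N_Suc[OF k] MN(1)
      by (intro positive_lower_bidiagonal_rescaled L that) (use k d_pos in auto)
    then show ?thesis
      using N_stochastic[OF k] MN by simp
  qed
  ultimately show ?thesis
    by auto
qed

end
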